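(* Let $P$ be a poset with no infinite antichain. Then the following are equivalent: (i) $P$ is bqo; (ii) $(P;\leq_{succ})$ is bqo; (iii) $(P;\leq_{pred})$ is bqo; (iv) $(P;\leq_{crit})$ is bqo; (v) $AM(P)$ is bqo.
   Context: For $a,b\in P$: $a\leq_{pred} b$ iff every $x\in P$ with $x<a$ satisfies $x<b$; $a\leq_{succ} b$ iff every $y\in P$ with $b<y$ satisfies $a<y$; $a\leq_{crit} b$ iff both $a\leq_{pred} b$ and $a\leq_{succ} b$. These are quasi-orders on $P$. $AM(P)$ is the set of maximal antichains of $P$, ordered by domination: $X\leq Y$ iff for every $x\in X$ there is $y\in Y$ with $x\leq y$. Barriers and bqo: finite subsets of $\mathbb{N}$ are identified with their increasing enumerations. For finite $s,t\subseteq\mathbb{N}$ write $s\triangleleft t$ if there is a finite $r\subseteq\mathbb{N}$ such that $s$ is a proper initial segment of $r$ and $t$ is $r$ with its least element removed. A barrier is an infinite set $B$ of finite subsets of $\mathbb{N}$, no member of which is a proper subset of another, such that every infinite $X\subseteq\bigcup B$ has a nonempty initial segment belonging to $B$. A barrier is well-ordered by the lexicographic order; its order type is the type of this well-order. A map $f$ from a barrier $B$ into a quasi-ordered set $Q$ is good if there exist $s,t\in B$ with $s\triangleleft t$ and $f(s)\leq f(t)$, and bad otherwise. For a countable ordinal $\alpha$, $Q$ is $\alpha$-bqo if every map from a barrier of order type at most $\alpha$ into $Q$ is good; $Q$ is better-quasi-ordered (bqo) if it is $\alpha$-bqo for every countable ordinal $\alpha$. *)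

theory Defs
  imports Main
begin

definition le_pred :: "'a::order \<Rightarrow> 'a \<Rightarrow> bool" where
  "le_pred a b \<longleftrightarrow> (\<forall>x. x < a \<longrightarrow> x < b)"

definition le_succ :: "'a::order \<Rightarrow> 'a \<Rightarrow> bool" where
  "le_succ a b \<longleftrightarrow> (\<forall>y. b < y \<longrightarrow> a < y)"

definition le_crit :: "'a::order \<Rightarrow> 'a \<Rightarrow> bool" where
  "le_crit a b \<longleftrightarrow> le_pred a b \<and> le_succ a b"

definition antichain :: "'a::order set \<Rightarrow> bool" where
  "antichain A \<longleftrightarrow> (\<forall>x\<in>A. \<forall>y\<in>A. x \<noteq> y \<longrightarrow> \<not> x \<le> y \<and> \<not> y \<le> x)"

definition max_antichain :: "'a::order set \<Rightarrow> bool" where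
  "max_antichain A \<longleftrightarrow> antichain A \<and> (\<forall>B. antichain B \<and> A \<subseteq> B \<longrightarrow> B = A)"

definition AM :: "'a::order set set" where
  "AM = {A. max_antichain A}"

definition dominates :: "'a::order set \<Rightarrow> 'a set \<Rightarrow> bool" where
  "dominates X Y \<longleftrightarrow> (\<forall>x\<in>X. \<exists>y\<in>Y. x \<le> y)"

text \<open>Finite subsets of nat are identified with their increasing enumerations.\<close>

definition init_seg :: "nat set \<Rightarrow> nat set \<Rightarrow> bool" where
  "init_seg s X \<longleftrightarrow> s \<subseteq> X \<and> (\<forall>x\<in>X. \<forall>y\<in>s. x < y \<longrightarrow> x \<in> s)"

definition tri :: "nat set \<Rightarrow> nat set \<Rightarrow> bool" where
  "tri s t \<longleftrightarrow> (\<exists>r. finite r \<and> init_seg s r \<and> s \<noteq> r \<and> t = r - {Min r})"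

definition barrier :: "nat set set \<Rightarrow> bool" where
  "barrier B \<longleftrightarrow> infinite B \<and> (\<forall>s\<in>B. finite s)
     \<and> (\<forall>s\<in>B. \<forall>t\<in>B. \<not> s \<subset> t)
     \<and> (\<forall>X. infinite X \<and> X \<subseteq> \<Union>B \<longrightarrow> (\<exists>s\<in>B. s \<noteq> {} \<and> init_seg s X))"

definition good :: "('b \<Rightarrow> 'b \<Rightarrow> bool) \<Rightarrow> nat set set \<Rightarrow> (nat set \<Rightarrow> 'b) \<Rightarrow> bool" where
  "good le B f \<longleftrightarrow> (\<exists>s\<in>B. \<exists>t\<in>B. tri s t \<and> le (f s) (f t))"

definition bqo :: "'b set \<Rightarrow> ('b \<Rightarrow> 'b \<Rightarrow> bool) \<Rightarrow> bool" where
  "bqo Q le \<longleftrightarrow> (\<forall>B f. barrier B \<and> f ` B \<subseteq> Q \<longrightarrow> good le B f)"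

end

theory Submission
  imports Defs "HOL-Library.Infinite_Set"
begin

text \<open>
  Barriers can be replaced by locally constant maps \<open>F\<close> on the infinite subsets of an infinite
  \<open>A \<subseteq> \<nat>\<close>: a quasi-order is bqo iff every such \<open>F\<close> has an \<open>X\<close> with
  \<open>F X \<le> F (shift X)\<close>, where \<open>shift\<close> removes the least element. A locally constant map
  factors through the front of a well-founded tree, which allows induction on the tree and
  yields Ramsey's theorem for clopen partitions.

  Each of the conditions forces \<open>P\<close> to be well-founded. If \<open>P\<close> is not bqo, Ramsey's theorem gives
  an \<open>F\<close> with \<open>F X\<close> and \<open>F (shift X)\<close> always incomparable. Let \<open>s\<close>, \<open>t\<close> be the front segments
  of \<open>X\<close> and \<open>shift X\<close>, let \<open>W\<close> be \<open>X\<close> without \<open>t - s\<close>, and let \<open>G X = F (shift W)\<close>. By Ramsey's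
  theorem the relation between \<open>F (shift X)\<close> and \<open>G X\<close> may be taken constant. Incomparability
  gives an infinite antichain and \<open>>\<close> an infinite descent, while equality shows that \<open>F\<close> factors
  through a proper subtree. So \<open>F (shift X) < G X\<close>, where \<open>G X = F (shift W)\<close> is incomparable to
  \<open>F W = F X\<close>. Then \<open>G\<close> is bad for \<open>le_pred\<close>, and \<open>F\<close> is bad for \<open>le_succ\<close> on a subset.

  For maximal antichains, \<open>a\<close> is mapped to \<open>a\<close> together with the minimal elements incomparable
  to \<open>a\<close>; domination of the images implies \<open>le_pred\<close>.
\<close>

section \<open>Infinite sets of natural numbers\<close>

definition infsets :: "nat set \<Rightarrow> nat set set" where
  "infsets A = {X. X \<subseteq> A \<and> infinite X}"

definition shift :: "nat set \<Rightarrow> nat set" where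
  "shift X = X - {Inf X}"

definition beyond :: "nat set \<Rightarrow> nat \<Rightarrow> nat set" where
  "beyond A n = {x \<in> A. n < x}"

lemma infsetsI: "X \<subseteq> A \<Longrightarrow> infinite X \<Longrightarrow> X \<in> infsets A"
  by (simp add: infsets_def)

lemma infsetsD: "X \<in> infsets A \<Longrightarrow> X \<subseteq> A" "X \<in> infsets A \<Longrightarrow> infinite X"
  by (simp_all add: infsets_def)

lemma infsets_trans: "X \<in> infsets Y \<Longrightarrow> Y \<in> infsets A \<Longrightarrow> X \<in> infsets A"
  by (auto simp: infsets_def)

lemma infsets_mono: "X \<in> infsets Y \<Longrightarrow> Y \<subseteq> A \<Longrightarrow> X \<in> infsets A"
  by (auto simp: infsets_def)

lemma Inf_in: "infinite (X :: nat set) \<Longrightarrow> Inf X \<in> X"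
  by (metis Inf_nat_def1 finite.emptyI)

lemma Inf_le: "x \<in> (X :: nat set) \<Longrightarrow> Inf X \<le> x"
  by (rule cInf_lower) auto

lemma Inf_eq_least: "n \<in> X \<Longrightarrow> (\<And>x. x \<in> X \<Longrightarrow> n \<le> x) \<Longrightarrow> Inf X = (n :: nat)"
  by (rule cInf_eq_minimum) auto

lemma Inf_subset_eq: "Inf X \<in> V \<Longrightarrow> V \<subseteq> X \<Longrightarrow> Inf V = Inf (X :: nat set)"
  by (rule Inf_eq_least) (auto intro: Inf_le)

lemma infinite_shift [simp]: "infinite (shift X) \<longleftrightarrow> infinite X"
  by (simp add: shift_def)

lemma shift_subset: "shift X \<subseteq> X"
  by (auto simp: shift_def)

lemma shift_infsets: "X \<in> infsets A \<Longrightarrow> shift X \<in> infsets A"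
  by (auto simp: infsets_def shift_def)

lemma insert_Inf_shift: "infinite X \<Longrightarrow> insert (Inf X) (shift X) = X"
  using Inf_in[of X] by (auto simp: shift_def)

lemma shift_eq_beyond: "shift X = beyond X (Inf X)"
  using Inf_le[of _ X] by (force simp: shift_def beyond_def)

lemma less_shift: "x \<in> shift X \<Longrightarrow> Inf X < x"
  by (simp add: shift_eq_beyond beyond_def)

lemma beyond_subset: "beyond A n \<subseteq> A"
  by (auto simp: beyond_def)

lemma beyond_mono: "B \<subseteq> A \<Longrightarrow> beyond B n \<subseteq> beyond A n"
  by (auto simp: beyond_def)

lemma infinite_beyond [simp]: "infinite (beyond A n) \<longleftrightarrow> infinite A"
proof -
  have "A = beyond A n \<union> (A \<inter> {..n})"
    by (auto simp: beyond_def)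
  then have "finite (beyond A n) \<Longrightarrow> finite A"
    by (metis finite_Int finite_Un finite_atMost)
  then show ?thesis
    using finite_subset[OF beyond_subset] by blast
qed

lemma Inf_insert_beyond: "Y \<subseteq> beyond A n \<Longrightarrow> Inf (insert n Y) = n"
  by (rule Inf_eq_least) (auto simp: beyond_def)

lemma shift_insert_beyond: "Y \<subseteq> beyond A n \<Longrightarrow> shift (insert n Y) = Y"
  by (auto simp: shift_def Inf_insert_beyond beyond_def)

lemma shift_in_beyond: "Y \<in> infsets A \<Longrightarrow> shift Y \<in> infsets (beyond A (Inf Y))"
  by (auto simp: infsets_def beyond_def dest: less_shift subsetD[OF shift_subset])

lemma insert_infsets: "Y \<in> infsets (beyond A n) \<Longrightarrow> n \<in> A \<Longrightarrow> insert n Y \<in> infsets A"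
  by (auto simp: infsets_def beyond_def)

lemma infinite_greater:
  assumes "infinite (A :: nat set)" "finite s"
  shows "infinite {x \<in> A. \<forall>y\<in>s. y < x}"
proof -
  obtain m where "\<forall>y\<in>s. y < m"
    using assms(2) finite_nat_set_iff_bounded by auto
  then have "beyond A m \<subseteq> {x \<in> A. \<forall>y\<in>s. y < x}"
    by (auto simp: beyond_def)
  then show ?thesis
    using assms(1) infinite_super infinite_beyond by blast
qed

text \<open>A fusion argument: repeatedly replace the current set \<open>B\<close>, with least
  element \<open>n\<close>, by a \<open>C\<close> beyond \<open>n\<close> such that
  \<open>R n C\<close>. The least elements form \<open>X\<close>; its part beyond \<open>n\<close>
  lies in the \<open>C\<close> chosen for \<open>n\<close>, and \<open>R n\<close> passes to
  infinite subsets.\<close>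

lemma diagonal_infset:
  assumes "infinite A"
    and step: "\<And>n B. n \<in> A \<Longrightarrow> B \<in> infsets A \<Longrightarrow> \<exists>C \<in> infsets (beyond B n). R n C"
    and hereditary: "\<And>n C C'. R n C \<Longrightarrow> C' \<in> infsets C \<Longrightarrow> R n C'"
  shows "\<exists>X \<in> infsets A. \<forall>n\<in>X. R n (beyond X n)"
proof -
  obtain c where c: "\<And>n B. n \<in> A \<Longrightarrow> B \<in> infsets A \<Longrightarrow> c n B \<in> infsets (beyond B n) \<and> R n (c n B)"
    using step by metis
  define S where "S = rec_nat A (\<lambda>_ B. c (Inf B) B)"
  have S0: "S 0 = A" and SS: "S (Suc i) = c (Inf (S i)) (S i)" for i
    by (simp_all add: S_def)
  have SA: "S i \<in> infsets A" for i
  proof (induction i)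
    case 0
    then show ?case using \<open>infinite A\<close> by (simp add: S0 infsets_def)
  next
    case (Suc i)
    then have "Inf (S i) \<in> A"
      using Inf_in[OF infsetsD(2)[OF Suc]] infsetsD(1)[OF Suc] by auto
    then have "S (Suc i) \<in> infsets (beyond (S i) (Inf (S i)))"
      using c Suc SS by simp
    then show ?case
      using infsets_trans[OF infsets_mono[OF _ beyond_subset] Suc] by blast
  qed
  have InA: "Inf (S i) \<in> S i" "Inf (S i) \<in> A" for i
    using Inf_in[OF infsetsD(2)[OF SA]] infsetsD(1)[OF SA] by auto
  have SSuc: "S (Suc i) \<in> infsets (beyond (S i) (Inf (S i)))" "R (Inf (S i)) (S (Suc i))" for i
    using c[OF InA(2) SA] SS by simp_all
  have anti: "S j \<subseteq> S i" if "i \<le> j" for i j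
    using that
  proof (induction rule: dec_induct)
    case (step j)
    have "S (Suc j) \<subseteq> S j"
      using infsetsD(1)[OF SSuc(1)] beyond_subset by blast
    then show ?case using step by blast
  qed simp
  define X where "X = range (\<lambda>i. Inf (S i))"
  have mono: "strict_mono (\<lambda>i. Inf (S i))"
    unfolding strict_mono_Suc_iff
  proof
    fix i
    have "Inf (S (Suc i)) \<in> beyond (S i) (Inf (S i))"
      using InA(1) infsetsD(1)[OF SSuc(1)] by blast
    then show "Inf (S i) < Inf (S (Suc i))"
      by (simp add: beyond_def)
  qed
  have sm: "Inf (S i) < Inf (S j) \<longleftrightarrow> i < j" for i j
    using strict_mono_less[OF mono] by simp
  have inj: "inj (\<lambda>i. Inf (S i))"
    by (rule strict_mono_imp_inj_on[OF mono])
  have "infinite X"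
    unfolding X_def using inj range_inj_infinite by blast
  moreover have "X \<subseteq> A"
    using InA(2) by (auto simp: X_def)
  moreover have "R n (beyond X n)" if n: "n \<in> X" for n
  proof -
    obtain i where i: "n = Inf (S i)"
      using n by (auto simp: X_def)
    have "beyond X n \<subseteq> S (Suc i)"
      using anti InA(1) sm by (fastforce simp: beyond_def X_def i dest: Suc_leI)
    then show ?thesis
      using SSuc(2)[of i] hereditary \<open>infinite X\<close> i by (simp add: infsets_def)
  qed
  ultimately show ?thesis
    by (auto simp: infsets_def)
qed

section \<open>Locally constant maps and well-founded trees\<close>

text \<open>This is continuity into a discrete space, on the infinite subsets of \<open>A\<close>
  with the topology of Cantor space; the bound \<open>m\<close> may depend on
  \<open>X\<close>.\<close>

definition loc_const :: "nat set \<Rightarrow> (nat set \<Rightarrow> 'b) \<Rightarrow> bool" where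
  "loc_const A F \<longleftrightarrow> (\<forall>X \<in> infsets A. \<exists>m. \<forall>Y \<in> infsets A. Y \<inter> {..<m} = X \<inter> {..<m} \<longrightarrow> F Y = F X)"

text \<open>Only the branching is recorded, the edge to the child \<open>k n\<close> standing for
  the number \<open>n\<close>. The datatype excludes infinite branches, so structural induction
  takes the place of induction on countable ordinals.\<close>

datatype tree = Leaf | Node "nat \<Rightarrow> tree"

text \<open>The branch along which \<open>X\<close> descends, its elements being read in increasing
  order until a leaf is reached. These branches form a front.\<close>

primrec seg :: "tree \<Rightarrow> nat set \<Rightarrow> nat set" where
  "seg Leaf = (\<lambda>X. {})"
| "seg (Node k) = (\<lambda>X. insert (Inf X) (seg (k (Inf X)) (shift X)))"

definition ranked :: "tree \<Rightarrow> nat set \<Rightarrow> (nat set \<Rightarrow> 'b) \<Rightarrow> bool" where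
  "ranked T A F \<longleftrightarrow> (\<forall>X \<in> infsets A. \<forall>Y \<in> infsets A. seg T X = seg T Y \<longrightarrow> F X = F Y)"

lemma rankedD:
  "ranked T A F \<Longrightarrow> X \<in> infsets A \<Longrightarrow> Y \<in> infsets A \<Longrightarrow> seg T X = seg T Y \<Longrightarrow> F X = F Y"
  unfolding ranked_def by blast

lemma finite_seg [simp]: "finite (seg T X)"
  by (induction T arbitrary: X) auto

lemma seg_subset: "infinite X \<Longrightarrow> seg T X \<subseteq> X"
proof (induction T arbitrary: X)
  case (Node k)
  have "seg (k (Inf X)) (shift X) \<subseteq> shift X"
    using Node by auto
  then show ?case
    using shift_subset[of X] Inf_in[OF Node.prems] by auto
qed simp

lemma init_seg_seg: "infinite X \<Longrightarrow> init_seg (seg T X) X"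
proof (induction T arbitrary: X)
  case (Node k)
  have "init_seg (seg (k (Inf X)) (shift X)) (shift X)"
    using Node by auto
  moreover have "\<not> x < Inf X" if "x \<in> X" for x
    using Inf_le[OF that] by simp
  ultimately show ?case
    using Inf_in[OF Node.prems] unfolding init_seg_def shift_def seg.simps by blast
qed (simp add: init_seg_def)

text \<open>At a node the segment contains \<open>Inf X\<close>, which is therefore also the least
  element of \<open>Y\<close>; the tails are compared in the subtree. It follows that no segment
  properly prolongs another one.\<close>

lemma seg_cong:
  "init_seg (seg T X) Y \<Longrightarrow> infinite X \<Longrightarrow> infinite Y \<Longrightarrow> seg T Y = seg T X"
proof (induction T arbitrary: X Y)
  case (Node k)
  let ?n = "Inf X"
  have sub: "seg (k ?n) (shift X) \<subseteq> shift X"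
    using Node.prems seg_subset infinite_shift by blast
  then have n_notin: "?n \<notin> seg (k ?n) (shift X)"
    by (auto simp: shift_def)
  have nY: "?n \<in> Y"
    using Node.prems(1) by (simp add: init_seg_def)
  have Inf_Y: "Inf Y = ?n"
  proof (rule Inf_eq_least[OF nY])
    fix x assume x: "x \<in> Y"
    show "?n \<le> x"
    proof (rule ccontr)
      assume "\<not> ?n \<le> x"
      then have "x \<in> seg (Node k) X"
        using x Node.prems(1) by (auto simp: init_seg_def)
      then show False
        using \<open>\<not> ?n \<le> x\<close> seg_subset[OF Node.prems(2)] Inf_le by blast
    qed
  qed
  have "init_seg (seg (k ?n) (shift X)) (shift Y)"
    using Node.prems(1) n_notin Inf_Y by (auto simp: init_seg_def shift_def)
  then have "seg (k ?n) (shift Y) = seg (k ?n) (shift X)"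
    using Node.IH[of "k ?n" "shift X" "shift Y"] Node.prems by auto
  then show ?case
    by (simp add: Inf_Y)
qed simp

lemma seg_between: "seg T X \<subseteq> V \<Longrightarrow> V \<subseteq> X \<Longrightarrow> infinite V \<Longrightarrow> seg T V = seg T X"
  using init_seg_seg[of X T] infinite_super[of V X]
  by (intro seg_cong) (auto simp: init_seg_def)

lemma init_seg_agree:
  assumes "init_seg s X" "s \<subseteq> {..<m}" "Y \<inter> {..<m} = X \<inter> {..<m}"
  shows "init_seg s Y"
proof -
  have agree: "x \<in> Y \<longleftrightarrow> x \<in> X" if "x < m" for x
    using assms(3) that by blast
  have less: "y < m" if "y \<in> s" for y
    using assms(2) that by blast
  show ?thesis
    using assms(1) agree less unfolding init_seg_def by (meson order.strict_trans subset_iff)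
qed

lemma seg_agree:
  assumes "seg T X \<subseteq> {..<m}" "Y \<inter> {..<m} = X \<inter> {..<m}" "infinite X" "infinite Y"
  shows "seg T Y = seg T X"
  by (rule seg_cong[OF init_seg_agree[OF init_seg_seg[OF assms(3)] assms(1,2)] assms(3,4)])

lemma agree_mono:
  assumes "Y \<inter> {..<m} = X \<inter> {..<m}" "k \<le> (m :: nat)"
  shows "Y \<inter> {..<k} = X \<inter> {..<k}"
proof -
  have "Z \<inter> {..<k} = Z \<inter> {..<m} \<inter> {..<k}" for Z
    using assms(2) by auto
  then show ?thesis
    using assms(1) by metis
qed

lemma finite_bounded_lessThan: "finite (s :: nat set) \<Longrightarrow> \<exists>m. s \<subseteq> {..<m}"
  by (meson finite_nat_iff_bounded)

lemma ranked_imp_loc_const: "ranked T A F \<Longrightarrow> loc_const A F"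
  unfolding loc_const_def
proof
  fix X assume r: "ranked T A F" and X: "X \<in> infsets A"
  obtain m where m: "seg T X \<subseteq> {..<m}"
    using finite_bounded_lessThan[OF finite_seg[of T X]] by blast
  show "\<exists>m. \<forall>Y \<in> infsets A. Y \<inter> {..<m} = X \<inter> {..<m} \<longrightarrow> F Y = F X"
  proof (intro exI[of _ m] ballI impI)
    fix Y assume Y: "Y \<in> infsets A" "Y \<inter> {..<m} = X \<inter> {..<m}"
    have "seg T Y = seg T X"
      using seg_agree[OF m Y(2)] X Y(1) infsetsD(2) by simp
    then show "F Y = F X"
      by (rule rankedD[OF r Y(1) X])
  qed
qed

lemma ranked_mono: "ranked T A F \<Longrightarrow> B \<subseteq> A \<Longrightarrow> ranked T B F"
  unfolding ranked_def using infsets_mono by blast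

lemma ranked_Node:
  assumes "ranked (Node k) A F" "n \<in> A"
  shows "ranked (k n) (beyond A n) (\<lambda>X. F (insert n X))"
  unfolding ranked_def
proof (intro ballI impI)
  fix X Y assume X: "X \<in> infsets (beyond A n)" and Y: "Y \<in> infsets (beyond A n)"
    and eq: "seg (k n) X = seg (k n) Y"
  have "seg (Node k) (insert n X) = seg (Node k) (insert n Y)"
    using eq infsetsD(1)[OF X] infsetsD(1)[OF Y] by (simp add: Inf_insert_beyond shift_insert_beyond)
  then show "F (insert n X) = F (insert n Y)"
    by (rule rankedD[OF assms(1) insert_infsets[OF X assms(2)] insert_infsets[OF Y assms(2)]])
qed

lemma Inf_seg_Node: "infinite X \<Longrightarrow> Inf (seg (Node k) X) = Inf X"
  using seg_subset[of X "Node k"] by (intro Inf_eq_least) (auto intro: Inf_le)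

lemma seg_Node_minus: "infinite X \<Longrightarrow> seg (Node k) X - {Inf X} = seg (k (Inf X)) (shift X)"
  using seg_subset[of "shift X" "k (Inf X)"] by (auto simp: shift_def)

lemma ranked_NodeI:
  assumes "\<And>n. n \<in> A \<Longrightarrow> ranked (k n) (beyond A n) (\<lambda>X. F (insert n X))"
  shows "ranked (Node k) A F"
  unfolding ranked_def
proof (intro ballI impI)
  fix X Y assume X: "X \<in> infsets A" and Y: "Y \<in> infsets A"
    and eq: "seg (Node k) X = seg (Node k) Y"
  have inf: "infinite X" "infinite Y"
    using X Y infsetsD by auto
  have n: "Inf Y = Inf X"
    using eq Inf_seg_Node[OF inf(1)] Inf_seg_Node[OF inf(2)] by metis
  have "seg (k (Inf X)) (shift X) = seg (k (Inf X)) (shift Y)"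
    using eq seg_Node_minus[OF inf(1), of k] seg_Node_minus[OF inf(2), of k] n by metis
  moreover have "Inf X \<in> A"
    using Inf_in[OF infsetsD(2)[OF X]] infsetsD(1)[OF X] by auto
  ultimately have "F (insert (Inf X) (shift X)) = F (insert (Inf X) (shift Y))"
    using rankedD[OF assms shift_in_beyond[OF X]] shift_in_beyond[OF Y] n by simp
  then show "F X = F Y"
    using insert_Inf_shift[OF inf(1)] insert_Inf_shift[OF inf(2)] n by simp
qed

text \<open>Call a finite \<open>s\<close> bad if no tree ranks the map on the sets beyond
  \<open>s\<close> that prefixes \<open>s\<close>. If all one-point extensions of \<open>s\<close>
  had trees, these could be joined at a new root; so badness of the empty set propagates along an
  infinite set \<open>X\<close>. Near \<open>X\<close> the map is constant, and there a leaf
  suffices.\<close>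

lemma loc_const_imp_ranked:
  assumes "loc_const A F"
  shows "\<exists>T. ranked T A F"
proof (rule ccontr)
  assume contra: "\<not> ?thesis"
  define A' where "A' s = {x \<in> A. \<forall>y\<in>s. y < x}" for s
  define bad where "bad s \<longleftrightarrow> \<not> (\<exists>T. ranked T (A' s) (\<lambda>X. F (s \<union> X)))" for s
  have "bad {}"
    using contra by (simp add: bad_def A'_def)
  have ex: "\<exists>n \<in> A' s. bad (insert n s)" if "bad s" for s
  proof (rule ccontr)
    assume neg: "\<not> ?thesis"
    have A'_insert: "A' (insert n s) = beyond (A' s) n" if "n \<in> A' s" for n
      using that by (auto simp: A'_def beyond_def)
    have "\<forall>n \<in> A' s. \<exists>T. ranked T (beyond (A' s) n) (\<lambda>X. F (s \<union> insert n X))"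
      using neg A'_insert by (simp add: bad_def)
    then obtain k where "\<forall>n \<in> A' s. ranked (k n) (beyond (A' s) n) (\<lambda>X. F (s \<union> insert n X))"
      by metis
    then have "ranked (Node k) (A' s) (\<lambda>X. F (s \<union> X))"
      by (intro ranked_NodeI) auto
    then show False
      using \<open>bad s\<close> bad_def by blast
  qed
  define nxt where "nxt s = (SOME n. n \<in> A' s \<and> bad (insert n s))" for s
  define S where "S = rec_nat {} (\<lambda>_ s. insert (nxt s) s)"
  have S0: "S 0 = {}" and SS: "S (Suc i) = insert (nxt (S i)) (S i)" for i
    by (simp_all add: S_def)
  have nxt: "nxt s \<in> A' s \<and> bad (insert (nxt s) s)" if "bad s" for s
    unfolding nxt_def by (rule someI_ex) (use ex[OF that] in blast)
  have badS: "bad (S i)" for i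
    by (induction i) (auto simp: S0 SS nxt \<open>bad {}\<close>)
  define a where "a i = nxt (S i)" for i
  have S_eq: "S i = a ` {..<i}" for i
    by (induction i) (auto simp: S0 SS a_def lessThan_Suc)
  have "a i \<in> A' (S i)" for i
    using nxt[OF badS] by (simp add: a_def)
  then have a: "a i \<in> A" and "j < i \<Longrightarrow> a j < a i" for i j
    unfolding A'_def S_eq by blast+
  then have sm: "strict_mono a"
    by (intro strict_monoI)
  define X where "X = range a"
  have X: "X \<in> infsets A"
    unfolding X_def using a range_inj_infinite[OF strict_mono_imp_inj_on[OF sm]]
    by (intro infsetsI) auto
  obtain m where m: "\<And>Y. Y \<in> infsets A \<Longrightarrow> Y \<inter> {..<m} = X \<inter> {..<m} \<Longrightarrow> F Y = F X"
    using bspec[OF assms[unfolded loc_const_def] X] by auto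
  have ge: "i \<le> a i" for i
    using sm strict_mono_imp_increasing by blast
  \<comment> \<open>The index \<open>Suc m\<close> puts \<open>a m\<close> into the prefix. Since
    \<open>m \<le> a m\<close>, the remainder \<open>Y\<close> has no element below
    \<open>m\<close>, and all elements of \<open>X\<close> below \<open>m\<close> are already in the
    prefix.\<close>
  have "F (S (Suc m) \<union> Y) = F X" if Y: "Y \<in> infsets (A' (S (Suc m)))" for Y
  proof (rule m)
    show "S (Suc m) \<union> Y \<in> infsets A"
      using Y a by (auto simp: infsets_def A'_def S_eq)
    have "m < y" if "y \<in> Y" for y
    proof -
      have "a m < y"
        using that Y by (auto simp: infsets_def A'_def S_eq)
      then show ?thesis using ge[of m] by simp
    qed
    moreover have "X \<inter> {..<m} \<subseteq> S (Suc m)"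
    proof
      fix x assume "x \<in> X \<inter> {..<m}"
      then obtain i where "x = a i" "a i < m"
        by (auto simp: X_def)
      then show "x \<in> S (Suc m)"
        using ge[of i] by (simp add: S_eq)
    qed
    moreover have "S (Suc m) \<subseteq> X"
      by (auto simp: X_def S_eq)
    ultimately show "(S (Suc m) \<union> Y) \<inter> {..<m} = X \<inter> {..<m}"
      by fastforce
  qed
  then have "ranked Leaf (A' (S (Suc m))) (\<lambda>X. F (S (Suc m) \<union> X))"
    by (simp add: ranked_def)
  then show False
    using badS bad_def by blast
qed

section \<open>Closure properties of locally constant maps\<close>

lemma loc_const_subset: "loc_const A F \<Longrightarrow> B \<subseteq> A \<Longrightarrow> loc_const B F"
  using loc_const_imp_ranked ranked_mono ranked_imp_loc_const by metis

lemma loc_const_map2: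
  assumes "loc_const A F" "loc_const A G"
  shows "loc_const A (\<lambda>X. h (F X) (G X))"
  unfolding loc_const_def
proof
  fix X assume X: "X \<in> infsets A"
  obtain m where m: "\<And>Y. Y \<in> infsets A \<Longrightarrow> Y \<inter> {..<m} = X \<inter> {..<m} \<Longrightarrow> F Y = F X"
    using bspec[OF assms(1)[unfolded loc_const_def] X] by auto
  obtain m' where m': "\<And>Y. Y \<in> infsets A \<Longrightarrow> Y \<inter> {..<m'} = X \<inter> {..<m'} \<Longrightarrow> G Y = G X"
    using bspec[OF assms(2)[unfolded loc_const_def] X] by auto
  show "\<exists>m. \<forall>Y \<in> infsets A. Y \<inter> {..<m} = X \<inter> {..<m} \<longrightarrow> h (F Y) (G Y) = h (F X) (G X)"
  proof (intro exI[of _ "max m m'"] ballI impI)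
    fix Y assume Y: "Y \<in> infsets A" "Y \<inter> {..<max m m'} = X \<inter> {..<max m m'}"
    have "Y \<inter> {..<m} = X \<inter> {..<m}" "Y \<inter> {..<m'} = X \<inter> {..<m'}"
      using agree_mono[OF Y(2)] by simp_all
    then show "h (F Y) (G Y) = h (F X) (G X)"
      using m m' Y(1) by metis
  qed
qed

lemma loc_const_comp:
  assumes "loc_const A F"
    and "\<And>X. X \<in> infsets A \<Longrightarrow> \<phi> X \<in> infsets A"
    and "\<And>X n. X \<in> infsets A \<Longrightarrow> \<exists>m. \<forall>Y \<in> infsets A. Y \<inter> {..<m} = X \<inter> {..<m}
           \<longrightarrow> \<phi> Y \<inter> {..<n} = \<phi> X \<inter> {..<n}"
  shows "loc_const A (\<lambda>X. F (\<phi> X))"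
  unfolding loc_const_def
proof
  fix X assume X: "X \<in> infsets A"
  obtain n where n: "\<And>Y. Y \<in> infsets A \<Longrightarrow> Y \<inter> {..<n} = \<phi> X \<inter> {..<n} \<Longrightarrow> F Y = F (\<phi> X)"
    using bspec[OF assms(1)[unfolded loc_const_def] assms(2)[OF X]] by auto
  show "\<exists>m. \<forall>Y \<in> infsets A. Y \<inter> {..<m} = X \<inter> {..<m} \<longrightarrow> F (\<phi> Y) = F (\<phi> X)"
    using assms(3)[OF X, of n] n assms(2) by meson
qed

lemma Inf_agree:
  assumes "infinite (X :: nat set)" "infinite Y" "Inf X < m" "Y \<inter> {..<m} = X \<inter> {..<m}"
  shows "Inf Y = Inf X"
proof (rule Inf_eq_least)
  show "Inf X \<in> Y"
    using assms Inf_in[of X] by auto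
  fix x assume "x \<in> Y"
  then show "Inf X \<le> x"
    using assms Inf_le[of x X] by (cases "x < m") auto
qed

lemma loc_const_shift:
  assumes "loc_const A F"
  shows "loc_const A (\<lambda>X. F (shift X))"
proof (rule loc_const_comp[OF assms])
  fix X n assume X: "X \<in> infsets A"
  show "\<exists>m. \<forall>Y\<in>infsets A. Y \<inter> {..<m} = X \<inter> {..<m} \<longrightarrow> shift Y \<inter> {..<n} = shift X \<inter> {..<n}"
  \<comment> \<open>The agreement has to reach past \<open>Inf X\<close>, so that the same element
    is removed from both sets.\<close>
  proof (intro exI[of _ "max n (Suc (Inf X))"] ballI impI)
    fix Y assume Y: "Y \<in> infsets A" and eq: "Y \<inter> {..<max n (Suc (Inf X))} = X \<inter> {..<max n (Suc (Inf X))}"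
    have "Inf Y = Inf X"
      using Inf_agree[OF infsetsD(2)[OF X] infsetsD(2)[OF Y] _ eq] by simp
    then show "shift Y \<inter> {..<n} = shift X \<inter> {..<n}"
      using agree_mono[OF eq, of n] by (auto simp: shift_def)
  qed
qed (rule shift_infsets)

text \<open>Induction on the tree. The subtree \<open>k n\<close> ranks the colouring of the sets
  with least element \<open>n\<close>, so the induction hypothesis makes it constant after thinning.
  Fusion over all \<open>n\<close> leaves a colour that depends on the least element only, and the
  pigeonhole principle finishes.\<close>

lemma ranked_Ramsey:
  "ranked T A P \<Longrightarrow> infinite A \<Longrightarrow> \<exists>X \<in> infsets A. \<exists>b :: bool. \<forall>Y \<in> infsets X. P Y = b"
proof (induction T arbitrary: A P)
  case Leaf
  then have "\<forall>Y \<in> infsets A. P Y = P A"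
    by (intro ballI rankedD[OF Leaf.prems(1)]) (simp_all add: infsets_def)
  then show ?case
    using Leaf.prems(2) by (auto simp: infsets_def)
next
  case (Node k)
  have "\<exists>X \<in> infsets A. \<forall>n\<in>X. \<exists>b. \<forall>Y \<in> infsets (beyond X n). P (insert n Y) = b"
  proof (rule diagonal_infset[OF Node.prems(2)])
    fix n B assume n: "n \<in> A" and B: "B \<in> infsets A"
    have "ranked (k n) (beyond B n) (\<lambda>X. P (insert n X))"
      using ranked_mono[OF ranked_Node[OF Node.prems(1) n]] beyond_mono infsetsD(1)[OF B] by blast
    then show "\<exists>C \<in> infsets (beyond B n). \<exists>b. \<forall>Y \<in> infsets C. P (insert n Y) = b"
      using Node.IH[of "k n"] infsetsD(2)[OF B] by simp
  next
    fix n C C'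
    assume C: "\<exists>b. \<forall>Y \<in> infsets C. P (insert n Y) = b" and C': "C' \<in> infsets C"
    show "\<exists>b. \<forall>Y \<in> infsets C'. P (insert n Y) = b"
      using C infsets_trans[OF _ C'] by blast
  qed
  then obtain X where X: "X \<in> infsets A"
    and "\<forall>n\<in>X. \<exists>b. \<forall>Y \<in> infsets (beyond X n). P (insert n Y) = b"
    by blast
  then obtain b where b: "\<And>n Y. n \<in> X \<Longrightarrow> Y \<in> infsets (beyond X n) \<Longrightarrow> P (insert n Y) = b n"
    by metis
  have "X = {n \<in> X. b n} \<union> {n \<in> X. \<not> b n}"
    by auto
  then have "infinite {n \<in> X. b n} \<or> infinite {n \<in> X. \<not> b n}"
    using infsetsD(2)[OF X] by (metis finite_UnI)
  then obtain c where c: "infinite {n \<in> X. b n = c}"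
    using that[of True] that[of False] by auto
  let ?X = "{n \<in> X. b n = c}"
  have "P Y = c" if Y: "Y \<in> infsets ?X" for Y
  proof -
    have "Y \<in> infsets X" "Inf Y \<in> ?X"
      using Y Inf_in[of Y] by (auto simp: infsets_def)
    then have "P (insert (Inf Y) (shift Y)) = c"
      using b[of "Inf Y" "shift Y"] shift_in_beyond by auto
    then show ?thesis
      using insert_Inf_shift infsetsD(2)[OF Y] by simp
  qed
  moreover have "?X \<in> infsets A"
    using c X by (auto simp: infsets_def)
  ultimately show ?case
    by blast
qed

lemma clopen_Ramsey:
  assumes "loc_const A P" "infinite A"
  obtains X where "X \<in> infsets A" "(\<forall>Y \<in> infsets X. P Y) \<or> (\<forall>Y \<in> infsets X. \<not> P Y)"
  using loc_const_imp_ranked[OF assms(1)] ranked_Ramsey[OF _ assms(2)] by metis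

section \<open>Barriers and locally constant maps\<close>

lemma init_seg_linear: "init_seg s X \<Longrightarrow> init_seg t X \<Longrightarrow> s \<subseteq> t \<or> t \<subseteq> s"
proof (rule ccontr)
  assume st: "init_seg s X" "init_seg t X" and "\<not> (s \<subseteq> t \<or> t \<subseteq> s)"
  then obtain x y where "x \<in> s" "x \<notin> t" "y \<in> t" "y \<notin> s"
    by blast
  then show False
    using st unfolding init_seg_def by (cases x y rule: linorder_cases) blast+
qed

section \<open>Prolonging finite sets to infinite ones\<close>

definition extend :: "nat set \<Rightarrow> nat set \<Rightarrow> nat set" where
  "extend s X = s \<union> {x \<in> X. \<forall>y\<in>s. y < x}"

lemma infinite_extend: "infinite X \<Longrightarrow> finite s \<Longrightarrow> infinite (extend s X)"
  using infinite_greater[of X s] by (simp add: extend_def)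

lemma extend_infsets: "infinite X \<Longrightarrow> finite s \<Longrightarrow> s \<subseteq> X \<Longrightarrow> extend s X \<in> infsets X"
  using infinite_extend[of X s] by (auto simp: infsets_def extend_def)

lemma init_seg_extend: "init_seg s r \<Longrightarrow> init_seg s (extend r X)"
  unfolding init_seg_def extend_def by (auto dest: less_asym)

lemma Inf_extend:
  assumes "finite r" "r \<noteq> {}"
  shows "Inf (extend r X) = Min r"
proof (rule Inf_eq_least)
  fix x assume "x \<in> extend r X"
  then show "Min r \<le> x"
    using Min_in[OF assms] Min_le[OF assms(1)] unfolding extend_def by (auto intro: less_imp_le simp del: Min_le_iff)
qed (use assms in \<open>simp add: extend_def\<close>)

lemma barrier_unique:
  assumes "barrier B" "s \<in> B" "t \<in> B" "init_seg s X" "init_seg t X"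
  shows "s = t"
  using assms init_seg_linear[OF assms(4,5)] unfolding barrier_def by blast

text \<open>The front of a tree need not be an antichain for inclusion; Ramsey's theorem makes it
  one on an infinite set, since otherwise one could shrink its members forever.\<close>

lemma front_contains_barrier:
  assumes "infinite A" and T: "T = Node k"
  obtains X where "X \<in> infsets A" "barrier (seg T ` infsets X)"
proof -
  \<comment> \<open>The colour says whether the segment properly contains another segment. It
    depends on the segment alone, so \<open>T\<close> ranks it.\<close>
  have "ranked T A (\<lambda>X. \<exists>Y \<in> infsets A. seg T Y \<subset> seg T X)"
    by (simp add: ranked_def)
  from ranked_Ramsey[OF this assms(1)] obtain X b where X: "X \<in> infsets A"
    and hom: "\<forall>Y \<in> infsets X. (\<exists>Z \<in> infsets A. seg T Z \<subset> seg T Y) = b"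
    by (elim bexE exE)
  have b: "(\<exists>Z \<in> infsets A. seg T Z \<subset> seg T Y) = b" if "Y \<in> infsets X" for Y
    by (rule bspec[OF hom that])
  have infX: "infinite X" and XX: "X \<in> infsets X"
    using infsetsD(2)[OF X] by (auto simp: infsets_def)
  have "\<not> b"
  proof
    assume b_True: "b"
    obtain Y where Y: "Y \<in> infsets X"
      and least: "\<And>Z. Z \<in> infsets X \<Longrightarrow> card (seg T Y) \<le> card (seg T Z)"
      using ex_has_least_nat[of "\<lambda>Y. Y \<in> infsets X" X "\<lambda>Y. card (seg T Y)"] XX by blast
    obtain Z where Z: "Z \<in> infsets A" "seg T Z \<subset> seg T Y"
      using b[OF Y] b_True by blast
    \<comment> \<open>The set \<open>Z\<close> is only known to lie in \<open>A\<close>. Its segment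
      lies in \<open>X\<close>, so prolonging the segment inside \<open>X\<close> gives a member of
      \<open>infsets X\<close> with the same segment, against the minimality of
      \<open>Y\<close>.\<close>
    have "seg T Z \<subseteq> X"
      using Z(2) seg_subset[OF infsetsD(2)[OF Y], of T] infsetsD(1)[OF Y] by blast
    then have E: "extend (seg T Z) X \<in> infsets X"
      by (rule extend_infsets[OF infX finite_seg])
    have "seg T (extend (seg T Z) X) = seg T Z"
      by (rule seg_cong[OF init_seg_extend _ infsetsD(2)[OF E]])
        (simp_all add: init_seg_def infsetsD(2)[OF Z(1)])
    then have "card (seg T (extend (seg T Z) X)) < card (seg T Y)"
      using psubset_card_mono[OF finite_seg Z(2)] by simp
    then show False
      using least[OF E] by simp
  qed
  let ?B = "seg T ` infsets X"
  have ne: "seg T Y \<noteq> {}" for Y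
    by (simp add: T)
  have "X \<subseteq> \<Union>?B"
  proof
    fix x assume x: "x \<in> X"
    have Y: "insert x (beyond X x) \<in> infsets X"
      using x infX beyond_subset[of X x] by (intro infsetsI) auto
    have "Inf (insert x (beyond X x)) = x"
      by (rule Inf_insert_beyond[OF subset_refl])
    then have "x \<in> seg T (insert x (beyond X x))"
      by (simp add: T)
    then show "x \<in> \<Union>?B"
      using Y by blast
  qed
  moreover have sub: "\<Union>?B \<subseteq> X"
    using seg_subset infsetsD by blast
  ultimately have "infinite ?B"
    using infX by (metis finite_Union finite_seg finite_subset image_iff)
  moreover have "\<not> s \<subset> t" if "s \<in> ?B" "t \<in> ?B" for s t
    using that b \<open>\<not> b\<close> infsets_trans[OF _ X] by blast
  moreover have "\<exists>s\<in>?B. s \<noteq> {} \<and> init_seg s Y" if "infinite Y" "Y \<subseteq> \<Union>?B" for Y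
  proof (intro bexI conjI)
    show "seg T Y \<in> ?B"
      by (rule imageI[OF infsetsI[OF subset_trans[OF that(2) sub] that(1)]])
  qed (rule ne init_seg_seg[OF that(1)])+
  moreover have "\<forall>s\<in>?B. finite s"
    by simp
  ultimately have "barrier ?B"
    unfolding barrier_def by (intro conjI ballI allI impI) auto
  then show ?thesis
    using that X by blast
qed

text \<open>The map descends to the segments of a barrier, where some \<open>s\<close>,
  \<open>t\<close> with \<open>tri s t\<close> is good. The finite set \<open>r\<close> witnessing
  \<open>tri s t\<close> is prolonged inside \<open>X\<close> to an infinite set that has segment
  \<open>s\<close> and whose shift has segment \<open>t\<close>.\<close>

lemma bqo_loc_const:
  assumes bqo: "bqo Q le" and "infinite A" "loc_const A F" "\<And>X. X \<in> infsets A \<Longrightarrow> F X \<in> Q"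
  shows "\<exists>X \<in> infsets A. le (F X) (F (shift X))"
proof -
  obtain T0 where T0: "ranked T0 A F"
    using loc_const_imp_ranked[OF assms(3)] by blast
  \<comment> \<open>The front of a leaf consists of the empty set and is no barrier; a leaf is
    therefore replaced by a node all of whose children are leaves.\<close>
  obtain T k where T: "T = Node k" and r: "ranked T A F"
  proof (cases T0)
    case Leaf
    have "ranked (Node (\<lambda>_. Leaf)) A F"
      unfolding ranked_def by (intro ballI impI rankedD[OF T0]) (simp_all add: Leaf)
    then show ?thesis using that by blast
  qed (use T0 that in blast)
  obtain X where X: "X \<in> infsets A" and B: "barrier (seg T ` infsets X)"
    using front_contains_barrier[OF assms(2) T] by blast
  have infX: "infinite X"
    using infsetsD(2)[OF X] .
  have rX: "ranked T X F"
    by (rule ranked_mono[OF r infsetsD(1)[OF X]])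
  define f where "f s = F (SOME Y. Y \<in> infsets X \<and> seg T Y = s)" for s
  have f: "f (seg T Y) = F Y" if Y: "Y \<in> infsets X" for Y
  proof -
    define Z where "Z = (SOME Z. Z \<in> infsets X \<and> seg T Z = seg T Y)"
    have "Z \<in> infsets X \<and> seg T Z = seg T Y"
      unfolding Z_def by (rule someI[of _ Y]) (simp add: Y)
    then have "F Z = F Y"
      using rankedD[OF rX _ Y] by blast
    then show ?thesis
      by (simp add: f_def Z_def)
  qed
  have "f ` seg T ` infsets X \<subseteq> Q"
    using f assms(4) infsets_trans[OF _ X] by auto
  then have "good le (seg T ` infsets X) f"
    using bqo B unfolding bqo_def by blast
  then obtain s t r Y Z where Y: "Y \<in> infsets X" "s = seg T Y" and Z: "Z \<in> infsets X" "t = seg T Z"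
    and r: "finite r" "init_seg s r" "s \<noteq> r" "t = r - {Min r}" and le: "le (f s) (f t)"
    unfolding good_def tri_def by blast
  have inf: "infinite Y" "infinite Z"
    using Y Z infsetsD by auto
  have "s \<noteq> {}"
    by (simp add: Y T)
  then have "r \<noteq> {}"
    using r(2) by (auto simp: init_seg_def)
  then have "Min r \<in> r"
    using r(1) by simp
  \<comment> \<open>As \<open>s\<close> is a nonempty initial segment of \<open>r\<close>, it
    contains \<open>Min r\<close>. Hence \<open>r\<close>, which is \<open>t\<close> with
    \<open>Min r\<close> added, lies in \<open>X\<close>.\<close>
  have "Min r \<in> s"
  proof -
    obtain y where "y \<in> s"
      using \<open>s \<noteq> {}\<close> by blast
    then have "y \<in> r" "Min r \<le> y"
      using r(1,2) by (auto simp: init_seg_def)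
    then show ?thesis
      using r(2) \<open>y \<in> s\<close> \<open>Min r \<in> r\<close> unfolding init_seg_def by (metis le_neq_implies_less)
  qed
  moreover have "s \<subseteq> X" "t \<subseteq> X"
    using Y Z inf seg_subset infsetsD(1) by blast+
  ultimately have "r \<subseteq> X"
    using r(4) by blast
  then have E: "extend r X \<in> infsets X"
    by (rule extend_infsets[OF infX r(1)])
  have seg1: "seg T (extend r X) = seg T Y"
    using seg_cong[OF _ inf(1) infsetsD(2)[OF E]] init_seg_extend[OF r(2)] Y(2) by blast
  have "shift (extend r X) = extend r X - {Min r}"
    by (simp add: shift_def Inf_extend[OF r(1) \<open>r \<noteq> {}\<close>])
  also have "\<dots> = t \<union> {x \<in> X. \<forall>y\<in>r. y < x}"
    using \<open>Min r \<in> r\<close> by (auto simp: extend_def r(4))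
  finally have "init_seg t (shift (extend r X))"
    unfolding init_seg_def r(4) by (auto dest: less_asym)
  then have seg2: "seg T (shift (extend r X)) = seg T Z"
    using seg_cong[OF _ inf(2) infsetsD(2)[OF shift_infsets[OF E]]] Z(2) by blast
  have "f s = F (extend r X)" "f t = F (shift (extend r X))"
    using f[OF E] f[OF shift_infsets[OF E]] seg1 seg2 Y Z by simp_all
  then show ?thesis
    using le infsets_trans[OF E X] by auto
qed

text \<open>Conversely, a map on a barrier extends to infinite sets through the unique member of the
  barrier that begins the set. If \<open>s\<close> begins \<open>X\<close> and \<open>t\<close>
  begins \<open>shift X\<close>, then \<open>t\<close> together with \<open>Inf X\<close> witnesses
  \<open>tri s t\<close>.\<close>

lemma bqoI_loc_const:
  assumes lc: "\<And>A F. infinite A \<Longrightarrow> loc_const A F \<Longrightarrow> (\<And>X. X \<in> infsets A \<Longrightarrow> F X \<in> Q)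
                \<Longrightarrow> \<exists>X \<in> infsets A. le (F X) (F (shift X))"
  shows "bqo Q le"
  unfolding bqo_def
proof (intro allI impI)
  fix B f assume "barrier B \<and> f ` B \<subseteq> Q"
  then have B: "barrier B" and f: "\<And>s. s \<in> B \<Longrightarrow> f s \<in> Q"
    by auto
  let ?A = "\<Union>B"
  have "infinite ?A"
    using B finite_subset[of B "Pow ?A"] unfolding barrier_def by auto
  define F where "F X = f (THE s. s \<in> B \<and> init_seg s X)" for X
  have F: "F X = f s" if "s \<in> B" "init_seg s X" for s X
  proof -
    have "(THE s. s \<in> B \<and> init_seg s X) = s"
    proof (rule the_equality)
      show "u = s" if "u \<in> B \<and> init_seg u X" for u
        using barrier_unique[OF B conjunct1[OF that] \<open>s \<in> B\<close> conjunct2[OF that] \<open>init_seg s X\<close>] .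
    qed (simp add: that)
    then show ?thesis by (simp add: F_def)
  qed
  have ex: "\<exists>s\<in>B. s \<noteq> {} \<and> init_seg s X" if "X \<in> infsets ?A" for X
    using B that unfolding barrier_def infsets_def by blast
  have fin: "finite s" if "s \<in> B" for s
    using B that unfolding barrier_def by blast
  have "loc_const ?A F"
    unfolding loc_const_def
  proof
    fix X assume X: "X \<in> infsets ?A"
    obtain s where s: "s \<in> B" "init_seg s X"
      using ex[OF X] by blast
    obtain m where m: "s \<subseteq> {..<m}"
      using finite_bounded_lessThan[OF fin[OF s(1)]] by blast
    have "F Y = F X" if "Y \<inter> {..<m} = X \<inter> {..<m}" for Y
      using F[OF s(1) init_seg_agree[OF s(2) m that]] F[OF s] by simp
    then show "\<exists>m. \<forall>Y \<in> infsets ?A. Y \<inter> {..<m} = X \<inter> {..<m} \<longrightarrow> F Y = F X"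
      by blast
  qed
  moreover have "F X \<in> Q" if X: "X \<in> infsets ?A" for X
  proof -
    obtain s where "s \<in> B" "init_seg s X"
      using ex[OF X] by blast
    then show ?thesis
      using F f by simp
  qed
  ultimately obtain X where X: "X \<in> infsets ?A" and le: "le (F X) (F (shift X))"
    using lc[OF \<open>infinite ?A\<close>, of F] by blast
  obtain s where s: "s \<in> B" "s \<noteq> {}" "init_seg s X"
    using ex[OF X] by blast
  obtain t where t: "t \<in> B" "t \<noteq> {}" "init_seg t (shift X)"
    using ex[OF shift_infsets[OF X]] by blast
  let ?r = "insert (Inf X) t"
  have tX: "t \<subseteq> shift X"
    using t(3) by (simp add: init_seg_def)
  have nt: "Inf X \<notin> t"
    using tX by (auto simp: shift_def)
  have r: "init_seg ?r X"
    unfolding init_seg_def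
  proof (intro conjI ballI impI)
    show "?r \<subseteq> X"
      using tX shift_subset[of X] Inf_in[OF infsetsD(2)[OF X]] by blast
  next
    fix x y assume x: "x \<in> X" and y: "y \<in> ?r" and "x < y"
    then have "y \<in> t"
      using Inf_le[OF x] by auto
    then show "x \<in> ?r"
      using t(3) x \<open>x < y\<close> unfolding init_seg_def shift_def by blast
  qed
  \<comment> \<open>This is where the antichain condition enters: otherwise \<open>t\<close> would
    be a proper subset of \<open>s\<close>. Two initial segments of \<open>X\<close> being
    comparable, \<open>s\<close> is a proper part of \<open>?r\<close>.\<close>
  have "\<not> ?r \<subseteq> s"
  proof
    assume "?r \<subseteq> s"
    then have "t \<subset> s"
      using nt by blast
    then show False
      using B s(1) t(1) unfolding barrier_def by blast
  qed
  then have sr: "s \<subseteq> ?r" "s \<noteq> ?r"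
    using init_seg_linear[OF s(3) r] by auto
  have "init_seg s ?r"
    using sr(1) s(3) r unfolding init_seg_def by blast
  moreover have "Min ?r = Inf X"
    using fin[OF t(1)] tX less_shift[of _ X] by (intro Min_eqI) (auto intro: less_imp_le)
  then have "t = ?r - {Min ?r}"
    using nt by auto
  ultimately have "tri s t"
    unfolding tri_def using fin[OF t(1)] sr(2) by (intro exI[of _ ?r]) simp
  then show "good le B f"
    unfolding good_def using s(1) t(1) le F[OF s(1,3)] F[OF t(1,3)] by auto
qed

section \<open>Pairwise incomparable maps\<close>

definition inc :: "'a::order \<Rightarrow> 'a \<Rightarrow> bool" where
  "inc a b \<longleftrightarrow> \<not> a \<le> b \<and> \<not> b \<le> a"

text \<open>Only elements outside \<open>seg T X\<close> are deleted, so the segment of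
  \<open>X\<close>, and with it the value of a map ranked by \<open>T\<close>, is kept, while the
  value at the shift may change.\<close>

definition drop_seg :: "tree \<Rightarrow> nat set \<Rightarrow> nat set" where
  "drop_seg T X = seg T X \<union> (X - seg T X - seg T (shift X))"

lemma drop_seg_infsets: "X \<in> infsets A \<Longrightarrow> drop_seg T X \<in> infsets A"
  using seg_subset[of X T] by (auto simp: infsets_def drop_seg_def)

lemma drop_seg_subset: "infinite X \<Longrightarrow> drop_seg T X \<subseteq> X"
  using seg_subset[of X T] by (auto simp: drop_seg_def)

lemma seg_drop_seg: "infinite X \<Longrightarrow> seg T (drop_seg T X) = seg T X"
  using seg_subset[of X T] by (intro seg_between) (auto simp: drop_seg_def)

lemma funpow_drop_seg_infsets: "infinite X \<Longrightarrow> (drop_seg T ^^ i) X \<in> infsets X"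
proof (induction i)
  case 0
  then show ?case by (simp add: infsets_def)
qed (simp add: drop_seg_infsets)

lemma loc_const_drop_seg:
  assumes "loc_const A F"
  shows "loc_const A (\<lambda>X. F (drop_seg T X))"
proof (rule loc_const_comp[OF assms drop_seg_infsets])
  fix X n assume X: "X \<in> infsets A"
  \<comment> \<open>Agreement below \<open>p\<close> fixes the least element and both segments,
    hence also the set that is deleted.\<close>
  obtain p where p: "seg T X \<union> seg T (shift X) \<union> {Inf X} \<subseteq> {..<p}"
    using finite_bounded_lessThan[of "seg T X \<union> seg T (shift X) \<union> {Inf X}"] by auto
  show "\<exists>m. \<forall>Y\<in>infsets A. Y \<inter> {..<m} = X \<inter> {..<m} \<longrightarrow> drop_seg T Y \<inter> {..<n} = drop_seg T X \<inter> {..<n}"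
  proof (intro exI[of _ "max n p"] ballI impI)
    fix Y assume Y: "Y \<in> infsets A" and eq: "Y \<inter> {..<max n p} = X \<inter> {..<max n p}"
    have inf: "infinite X" "infinite Y"
      using X Y infsetsD by auto
    have eqp: "Y \<inter> {..<p} = X \<inter> {..<p}" and eqn: "Y \<inter> {..<n} = X \<inter> {..<n}"
      using agree_mono[OF eq] by simp_all
    have "Inf Y = Inf X"
      using Inf_agree[OF inf _ eqp] p by simp
    then have "shift Y \<inter> {..<p} = shift X \<inter> {..<p}"
      using eqp by (auto simp: shift_def)
    then have "seg T (shift Y) = seg T (shift X)"
      using seg_agree[of T "shift X" p "shift Y"] p inf by simp
    moreover have "seg T Y = seg T X"
      using seg_agree[OF _ eqp inf] p by simp
    ultimately show "drop_seg T Y \<inter> {..<n} = drop_seg T X \<inter> {..<n}"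
      using eqn by (auto simp: drop_seg_def)
  qed
qed

lemma init_seg_Un_greater:
  assumes s: "init_seg s Z" "s \<subseteq> r" "r \<subseteq> Z" and gt: "\<And>x y. x \<in> U \<Longrightarrow> y \<in> s \<Longrightarrow> y < x"
  shows "init_seg s (r \<union> U)"
  unfolding init_seg_def
proof (intro conjI ballI impI)
  fix x y assume "x \<in> r \<union> U" "y \<in> s" "x < y"
  then have "x \<in> r"
    using gt[of x y] by auto
  then show "x \<in> s"
    using s \<open>y \<in> s\<close> \<open>x < y\<close> unfolding init_seg_def by blast
qed (use s in blast)

text \<open>If dropping segments does not change the value, then \<open>F\<close> on \<open>shift X\<close> is
  already determined by the segments of a proper subtree.\<close>

lemma ranked_subtree:
  assumes r: "ranked T X F" and T: "T = Node k" and "infinite X"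
    and eq: "\<And>Y. Y \<in> infsets X \<Longrightarrow> F (shift Y) = F (shift (drop_seg T Y))"
  shows "ranked (k (Inf X)) (shift X) F"
proof -
  define n where "n = Inf X"
  have n: "n \<in> X"
    unfolding n_def by (rule Inf_in[OF assms(3)])
  have shiftX: "shift X = beyond X n"
    by (simp add: n_def shift_eq_beyond)
  have val: "F Z = F (\<sigma> \<union> U)"
    if Z: "Z \<in> infsets (shift X)" and \<sigma>: "\<sigma> = seg (k n) Z" and U: "U \<subseteq> shift X" "infinite U"
      and gt: "\<And>x y. x \<in> U \<Longrightarrow> y \<in> \<sigma> \<union> seg T Z \<Longrightarrow> y < x" for Z \<sigma> U
  proof -
    define t where "t = seg T Z"
    \<comment> \<open>The set \<open>V\<close> is built so that its segment is
      \<open>insert n \<sigma>\<close> and its shift has segment \<open>t\<close>, as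
      \<open>Z\<close> has. Dropping therefore deletes \<open>t - \<sigma>\<close>, and
      \<open>eq\<close> compares the value at \<open>Z\<close> with that at
      \<open>\<sigma> \<union> U\<close>.\<close>
    define V where "V = insert n (\<sigma> \<union> t \<union> U)"
    have infZ: "infinite Z" and ZX: "Z \<subseteq> shift X"
      using Z infsetsD by auto
    have \<sigma>Z: "\<sigma> \<subseteq> Z" "init_seg \<sigma> Z" and tZ: "t \<subseteq> Z" "init_seg t Z"
      using seg_subset[OF infZ] init_seg_seg[OF infZ] by (auto simp: \<sigma> t_def)
    have sub: "\<sigma> \<union> t \<union> U \<subseteq> beyond X n" "\<sigma> \<union> U \<subseteq> beyond X n"
      using \<sigma>Z tZ ZX U(1) shiftX by auto
    have V: "V \<in> infsets X"
      using sub(1) n U(2) beyond_subset[of X n] unfolding V_def by (intro infsetsI) auto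
    have shiftV: "shift V = \<sigma> \<union> t \<union> U" and InfV: "Inf V = n"
      unfolding V_def by (rule shift_insert_beyond[OF sub(1)], rule Inf_insert_beyond[OF sub(1)])
    have infV: "infinite (\<sigma> \<union> t \<union> U)"
      using U(2) by simp
    have "init_seg t (\<sigma> \<union> t \<union> U)" "init_seg \<sigma> (\<sigma> \<union> t \<union> U)"
      by (rule init_seg_Un_greater[OF tZ(2)] init_seg_Un_greater[OF \<sigma>Z(2)];
          use \<sigma>Z(1) tZ(1) gt in \<open>auto simp: t_def\<close>)+
    then have seg_shiftV: "seg T (shift V) = t" and seg_\<sigma>: "seg (k n) (shift V) = \<sigma>"
      using seg_cong[OF _ infZ infV] shiftV by (simp_all add: t_def \<sigma>)
    have segV: "seg T V = insert n \<sigma>"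
      using seg_\<sigma> InfV by (simp add: T)
    have "x \<notin> t \<and> x \<notin> \<sigma>" if "x \<in> U" for x
      using gt[OF that, of x] by (auto simp: t_def)
    then have "drop_seg T V = insert n (\<sigma> \<union> U)"
      unfolding drop_seg_def segV seg_shiftV unfolding V_def by blast
    then have "shift (drop_seg T V) = \<sigma> \<union> U"
      using shift_insert_beyond[OF sub(2)] by simp
    moreover have "F (shift V) = F Z"
      by (rule rankedD[OF r shift_infsets[OF V]])
        (use Z shift_subset[of X] infsets_mono seg_shiftV in \<open>auto simp: t_def\<close>)
    ultimately show ?thesis
      using eq[OF V] by simp
  qed
  show ?thesis
    unfolding ranked_def
  proof (intro ballI impI)
    fix Y Z assume Y: "Y \<in> infsets (shift X)" and Z: "Z \<in> infsets (shift X)"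
      and seg_eq: "seg (k (Inf X)) Y = seg (k (Inf X)) Z"
    \<comment> \<open>A common tail beyond the segments of both sets: \<open>val\<close> then sends
      \<open>Y\<close> and \<open>Z\<close> to the same set.\<close>
    define U where "U = {x \<in> shift X. \<forall>y \<in> seg (k n) Y \<union> seg T Y \<union> seg T Z. y < x}"
    have "infinite U"
      unfolding U_def using assms(3) by (intro infinite_greater) auto
    have "F Y = F (seg (k n) Y \<union> U)"
      by (rule val[OF Y refl _ \<open>infinite U\<close>]) (auto simp: U_def)
    moreover have "F Z = F (seg (k n) Y \<union> U)"
      by (rule val[OF Z _ _ \<open>infinite U\<close>]) (use seg_eq in \<open>auto simp: U_def n_def\<close>)
    ultimately show "F Y = F Z"
      by simp
  qed
qed

text \<open>Iterated dropping gives sets \<open>D i\<close>, and the values at their shifts form the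
  antichain. The hypothesis compares consecutive ones only; for arbitrary \<open>i < j\<close> an
  auxiliary set leads from \<open>D i\<close> to \<open>D j\<close> in a single drop.\<close>

lemma infinite_antichain_drop_seg:
  fixes F :: "nat set \<Rightarrow> 'a::order"
  assumes r: "ranked T X F" and T: "T = Node k" and "infinite X"
    and inc: "\<And>Y. Y \<in> infsets X \<Longrightarrow> inc (F (shift Y)) (F (shift (drop_seg T Y)))"
  shows "\<exists>A :: 'a set. infinite A \<and> antichain A"
proof -
  define D where "D i = (drop_seg T ^^ i) X" for i
  have D0: "D 0 = X" and DS: "D (Suc i) = drop_seg T (D i)" for i
    by (simp_all add: D_def)
  have D: "D i \<in> infsets X" for i
    unfolding D_def by (rule funpow_drop_seg_infsets[OF assms(3)])
  have infD: "infinite (D i)" for i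
    by (rule infsetsD(2)[OF D])
  have segD: "seg T (D i) = seg T X" for i
    by (induction i) (simp_all add: D0 DS seg_drop_seg[OF infD])
  have anti: "D j \<subseteq> D i" if "i \<le> j" for i j
    using that
  proof (induction rule: dec_induct)
    case (step j)
    then show ?case
      using drop_seg_subset[OF infD] DS by blast
  qed simp
  define p where "p i = F (shift (D i))" for i
  have inc_p: "inc (p i) (p j)" if "i < j" for i j
  proof -
    let ?s = "seg T X" and ?t = "seg T (shift (D i))"
    \<comment> \<open>\<open>V\<close> has the segment of \<open>X\<close> and its shift has the
      segment of \<open>shift (D i)\<close>, so its shift has value \<open>p i\<close>. As
      \<open>D j\<close> avoids the elements deleted from \<open>D i\<close>, dropping turns
      \<open>V\<close> into exactly \<open>D j\<close>.\<close>
    define V where "V = ?t \<union> D j"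
    have sD: "?s \<subseteq> D j" "?s \<subseteq> D i"
      using seg_subset[OF infD, of T] segD by auto
    have tD: "?t \<subseteq> shift (D i)"
      using seg_subset infD by simp
    have VD: "V \<subseteq> D i"
      using tD shift_subset[of "D i"] anti[of i j] that unfolding V_def by auto
    have infV: "infinite V"
      using infD by (simp add: V_def)
    have V: "V \<in> infsets X"
      using infsets_trans[OF infsetsI[OF VD infV] D] .
    have "Inf (D i) \<in> ?s"
      using segD[of i] T by (metis insertI1 seg.simps(2))
    then have "Inf V = Inf (D i)"
      using sD VD by (intro Inf_subset_eq) (auto simp: V_def)
    then have "?t \<subseteq> shift V" "shift V \<subseteq> shift (D i)"
      using tD VD by (auto simp: shift_def V_def)
    then have segV': "seg T (shift V) = ?t"
      using infV by (intro seg_between) auto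
    have segV: "seg T V = ?s"
      using seg_between[of T "D i" V] segD sD VD infV by (auto simp: V_def)
    have "D j \<subseteq> ?s \<union> (D i - ?s - ?t)"
      using anti[of "Suc i" j] that DS[of i] segD[of i] by (simp add: drop_seg_def)
    then have "drop_seg T V = D j"
      unfolding drop_seg_def segV segV' unfolding V_def using sD by blast
    moreover have "F (shift V) = p i"
      unfolding p_def by (rule rankedD[OF r shift_infsets[OF V] shift_infsets[OF D] segV'])
    ultimately show ?thesis
      using inc[OF V] by (simp add: p_def)
  qed
  have inc_p': "inc (p i) (p j)" if "i \<noteq> j" for i j
    using that inc_p[of i j] inc_p[of j i] by (auto simp: inc_def neq_iff)
  have "inj p"
  proof (rule injI, rule ccontr)
    fix i j assume "p i = p j" "i \<noteq> j"
    then show False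
      using inc_p'[of i j] by (simp add: inc_def)
  qed
  moreover have "antichain (range p)"
    using inc_p' unfolding antichain_def inc_def by (metis rangeE)
  ultimately show ?thesis
    using range_inj_infinite by blast
qed

text \<open>Induction on the tree; on a leaf the map is constant, contrary to incomparability. The
  conclusion asks for some \<open>W\<close> and does not mention \<open>drop_seg\<close>, because in
  the case of equality \<open>G\<close> comes from a subtree.\<close>

lemma incomparable_dominating_map:
  fixes F :: "nat set \<Rightarrow> 'a::order"
  assumes no_antichain: "\<not> (\<exists>A :: 'a set. infinite A \<and> antichain A)"
    and no_descent: "\<not> (\<exists>f :: nat \<Rightarrow> 'a. \<forall>i. f (Suc i) < f i)"
  shows "ranked T A F \<Longrightarrow> infinite A \<Longrightarrow> (\<And>X. X \<in> infsets A \<Longrightarrow> inc (F X) (F (shift X))) \<Longrightarrow>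
    \<exists>X \<in> infsets A. \<exists>G. loc_const X G \<and>
      (\<forall>Y \<in> infsets X. F (shift Y) < G Y \<and> (\<exists>W \<in> infsets X. F W = F Y \<and> G Y = F (shift W)))"
proof (induction T arbitrary: A)
  case Leaf
  have A: "A \<in> infsets A"
    using Leaf.prems(2) by (simp add: infsets_def)
  have "F A = F (shift A)"
    by (rule rankedD[OF Leaf.prems(1) A shift_infsets[OF A]]) simp
  then show ?case
    using Leaf.prems(3)[OF A] by (simp add: inc_def)
next
  case (Node k)
  let ?T = "Node k"
  define G where "G X = F (shift (drop_seg ?T X))" for X
  have lF: "loc_const A F"
    by (rule ranked_imp_loc_const[OF Node.prems(1)])
  have lS: "loc_const A (\<lambda>X. F (shift X))"
    by (rule loc_const_shift[OF lF])
  have lG: "loc_const A G"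
    unfolding G_def by (rule loc_const_drop_seg[OF lS])
  \<comment> \<open>Three successive thinnings decide \<open><\<close>, \<open>>\<close> and
    \<open>=\<close>; each decision persists on the later sets. If all are negative, the values are
    incomparable.\<close>
  obtain X1 where X1: "X1 \<in> infsets A"
    and c1: "(\<forall>Y \<in> infsets X1. F (shift Y) < G Y) \<or> (\<forall>Y \<in> infsets X1. \<not> F (shift Y) < G Y)"
    by (rule clopen_Ramsey[OF loc_const_map2[OF lS lG, of "(<)"] Node.prems(2)])
  obtain X2 where X2: "X2 \<in> infsets X1"
    and c2: "(\<forall>Y \<in> infsets X2. G Y < F (shift Y)) \<or> (\<forall>Y \<in> infsets X2. \<not> G Y < F (shift Y))"
    by (rule clopen_Ramsey[OF loc_const_subset[OF loc_const_map2[OF lG lS, of "(<)"] infsetsD(1)[OF X1]]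
          infsetsD(2)[OF X1]])
  obtain X where X: "X \<in> infsets X2"
    and c3: "(\<forall>Y \<in> infsets X. F (shift Y) = G Y) \<or> (\<forall>Y \<in> infsets X. F (shift Y) \<noteq> G Y)"
    by (rule clopen_Ramsey[OF loc_const_subset[OF loc_const_map2[OF lS lG, of "(=)"]
          infsetsD(1)[OF infsets_trans[OF X2 X1]]] infsetsD(2)[OF X2]])
  have X_in: "X \<in> infsets X1" "X \<in> infsets A"
    by (rule infsets_trans[OF X X2], rule infsets_trans[OF infsets_trans[OF X X2] X1])
  have infX: "infinite X"
    by (rule infsetsD(2)[OF X])
  have rX: "ranked ?T X F"
    by (rule ranked_mono[OF Node.prems(1) infsetsD(1)[OF X_in(2)]])
  consider (less) "\<forall>Y \<in> infsets X. F (shift Y) < G Y"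
    | (greater) "\<forall>Y \<in> infsets X. G Y < F (shift Y)"
    | (eq) "\<forall>Y \<in> infsets X. F (shift Y) = G Y"
    | (inc) "\<forall>Y \<in> infsets X. inc (F (shift Y)) (G Y)"
  proof -
    have inc: "inc (F (shift Y)) (G Y)"
      if "\<not> F (shift Y) < G Y" "\<not> G Y < F (shift Y)" "F (shift Y) \<noteq> G Y" for Y
      using that by (auto simp: inc_def order.order_iff_strict)
    have sub: "infsets X \<subseteq> infsets X1" "infsets X \<subseteq> infsets X2"
      using infsets_trans[OF _ X] infsets_trans[OF _ X_in(1)] by blast+
    from c1 show ?thesis
    proof
      assume n1: "\<forall>Y \<in> infsets X1. \<not> F (shift Y) < G Y"
      from c2 show ?thesis
      proof
        assume n2: "\<forall>Y \<in> infsets X2. \<not> G Y < F (shift Y)"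
        from c3 show ?thesis
        proof
          assume n3: "\<forall>Y \<in> infsets X. F (shift Y) \<noteq> G Y"
          show ?thesis
            using n1 n2 n3 sub by (intro that(4) ballI inc) blast+
        qed (rule that(3))
      qed (use sub that(2) in blast)
    qed (use sub that(1) in blast)
  qed
  then show ?case
  proof cases
    case less
    have "\<exists>W \<in> infsets X. F W = F Y \<and> G Y = F (shift W)" if Y: "Y \<in> infsets X" for Y
    proof (intro bexI conjI)
      show "drop_seg ?T Y \<in> infsets X"
        by (rule drop_seg_infsets[OF Y])
      then show "F (drop_seg ?T Y) = F Y"
        by (rule rankedD[OF rX _ Y seg_drop_seg[OF infsetsD(2)[OF Y]]])
    qed (simp add: G_def)
    then show ?thesis
      using less X_in(2) loc_const_subset[OF lG infsetsD(1)[OF X_in(2)]] by blast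
  next
    case greater
    define D where "D i = (drop_seg ?T ^^ i) X" for i
    have "D i \<in> infsets X" for i
      unfolding D_def by (rule funpow_drop_seg_infsets[OF infX])
    then have "\<forall>i. F (shift (D (Suc i))) < F (shift (D i))"
      using greater by (simp add: D_def G_def)
    then show ?thesis
      using no_descent exI[of "\<lambda>f. \<forall>i. f (Suc i) < f i" "\<lambda>i. F (shift (D i))"] by blast
  next
    case eq
    \<comment> \<open>The only case that uses the induction hypothesis.\<close>
    have "ranked (k (Inf X)) (shift X) F"
      by (rule ranked_subtree[OF rX refl infX]) (use eq G_def in simp)
    moreover have sX: "shift X \<in> infsets A"
      by (rule shift_infsets[OF X_in(2)])
    ultimately have "\<exists>Z \<in> infsets (shift X). \<exists>G. loc_const Z G \<and>
      (\<forall>Y \<in> infsets Z. F (shift Y) < G Y \<and> (\<exists>W \<in> infsets Z. F W = F Y \<and> G Y = F (shift W)))"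
      using Node.IH[OF rangeI, of "Inf X" "shift X"] Node.prems(3) infX infsets_trans[OF _ sX] by simp
    then show ?thesis
      using infsets_trans[OF _ sX] by blast
  next
    case inc
    then show ?thesis
      using infinite_antichain_drop_seg[OF rX refl infX] no_antichain G_def by simp
  qed
qed

section \<open>Comparing the quasi-orders\<close>

lemma bqo_mono:
  assumes bqo: "bqo Q le" and mono: "\<And>x y. le x y \<Longrightarrow> le' x y"
  shows "bqo Q le'"
  unfolding bqo_def
proof (intro allI impI)
  fix B f assume "barrier B \<and> f ` B \<subseteq> Q"
  then have "good le B f"
    using bqo by (simp add: bqo_def)
  then show "good le' B f"
    unfolding good_def using mono by blast
qed

text \<open>A sequence is a map that reads only the least element of a set, and the least element of
  \<open>shift X\<close> exceeds that of \<open>X\<close>.\<close>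

lemma bqo_imp_good_sequence:
  assumes "bqo Q le" "\<And>i :: nat. f i \<in> Q"
  shows "\<exists>i j. i < j \<and> le (f i) (f j)"
proof -
  have "loc_const UNIV (\<lambda>X. f (Inf X))"
    unfolding loc_const_def
  proof
    fix X :: "nat set" assume X: "X \<in> infsets UNIV"
    show "\<exists>m. \<forall>Y \<in> infsets UNIV. Y \<inter> {..<m} = X \<inter> {..<m} \<longrightarrow> f (Inf Y) = f (Inf X)"
      using Inf_agree[OF infsetsD(2)[OF X], of _ "Suc (Inf X)"] infsetsD(2)[of _ UNIV]
      by (intro exI[of _ "Suc (Inf X)"]) auto
  qed
  then obtain X where X: "X \<in> infsets UNIV" "le (f (Inf X)) (f (Inf (shift X)))"
    using bqo_loc_const[OF assms(1) infinite_UNIV_nat, of "\<lambda>X. f (Inf X)"] assms(2) by auto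
  have "Inf (shift X) \<in> shift X"
    by (rule Inf_in) (simp add: infsetsD(2)[OF X(1)])
  then show ?thesis
    using less_shift X(2) by blast
qed

text \<open>The map \<open>\<phi>\<close> allows one argument for all conditions: it is the identity
  for \<open>le_pred\<close> and \<open>le_succ\<close>, and a choice of maximal antichains for
  \<open>AM\<close>.\<close>

lemma bqo_imp_no_descent:
  assumes "bqo (Q :: 'b set) le"
    and "\<And>x. \<phi> x \<in> Q" "\<And>x y :: 'a::order. x < y \<Longrightarrow> \<not> le (\<phi> y) (\<phi> x)"
  shows "\<not> (\<exists>f :: nat \<Rightarrow> 'a. \<forall>i. f (Suc i) < f i)"
proof
  assume "\<exists>f :: nat \<Rightarrow> 'a. \<forall>i. f (Suc i) < f i"
  then obtain f :: "nat \<Rightarrow> 'a" where f: "\<And>i. f (Suc i) < f i"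
    by blast
  have "f j < f i" if "i < j" for i j
    using that by (induction rule: less_Suc_induct) (auto intro: f less_trans)
  then show False
    using bqo_imp_good_sequence[OF assms(1), of "\<lambda>i. \<phi> (f i)"] assms(2,3) by blast
qed

text \<open>For a bad map, Ramsey's theorem decides whether \<open>F (shift Y) \<le> F Y\<close>. A
  positive answer makes the values at the iterated shifts strictly decreasing.\<close>

lemma not_bqo_imp_incomparable:
  assumes "\<not> bqo (UNIV :: 'a::order set) (\<le>)"
    and no_descent: "\<not> (\<exists>f :: nat \<Rightarrow> 'a. \<forall>i. f (Suc i) < f i)"
  obtains A and F :: "nat set \<Rightarrow> 'a::order"
  where "infinite A" "loc_const A F" "\<And>X. X \<in> infsets A \<Longrightarrow> inc (F X) (F (shift X))"
proof -
  obtain A and F :: "nat set \<Rightarrow> 'a" where A: "infinite A" and F: "loc_const A F"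
    and bad: "\<And>X. X \<in> infsets A \<Longrightarrow> \<not> F X \<le> F (shift X)"
    using assms(1) bqoI_loc_const[of UNIV "(\<le>)"] by blast
  obtain X where X: "X \<in> infsets A"
    and hom: "(\<forall>Y \<in> infsets X. F (shift Y) \<le> F Y) \<or> (\<forall>Y \<in> infsets X. \<not> F (shift Y) \<le> F Y)"
    by (rule clopen_Ramsey[OF loc_const_map2[OF loc_const_shift[OF F] F, of "(\<le>)"] A])
  have infX: "infinite X"
    by (rule infsetsD(2)[OF X])
  from hom show ?thesis
  proof
    assume le: "\<forall>Y \<in> infsets X. F (shift Y) \<le> F Y"
    have D: "(shift ^^ i) X \<in> infsets X" for i
    proof (induction i)
      case 0
      then show ?case using infX by (simp add: infsets_def)
    qed (simp add: shift_infsets)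
    have "F ((shift ^^ Suc i) X) < F ((shift ^^ i) X)" for i
      using le D[of i] bad[OF infsets_trans[OF D X], of i] by (simp add: less_le_not_le)
    then show ?thesis
      using no_descent exI[of "\<lambda>f. \<forall>i. f (Suc i) < f i" "\<lambda>i. F ((shift ^^ i) X)"] by blast
  next
    assume "\<forall>Y \<in> infsets X. \<not> F (shift Y) \<le> F Y"
    then have "inc (F Y) (F (shift Y))" if "Y \<in> infsets X" for Y
      using that bad[OF infsets_trans[OF that X]] by (simp add: inc_def)
    then show ?thesis
      using that[OF infX loc_const_subset[OF F infsetsD(1)[OF X]]] by blast
  qed
qed

text \<open>If \<open>le_pred (G Y) (G (shift Y))\<close>, then \<open>F (shift Y) < G Y\<close>
  gives \<open>F (shift Y) < G (shift Y)\<close>. For the witness \<open>V\<close> belonging to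
  \<open>shift Y\<close> this reads \<open>F V < F (shift V)\<close>, against
  incomparability.\<close>

lemma bqo_le_pred_imp_bqo:
  assumes no_antichain: "\<not> (\<exists>A :: 'a::order set. infinite A \<and> antichain A)"
    and bqo: "bqo (UNIV :: 'a set) le_pred"
  shows "bqo (UNIV :: 'a set) (\<le>)"
proof (rule ccontr)
  assume neg: "\<not> ?thesis"
  have no_descent: "\<not> (\<exists>f :: nat \<Rightarrow> 'a. \<forall>i. f (Suc i) < f i)"
    by (rule bqo_imp_no_descent[OF bqo, of id]) (auto simp: le_pred_def)
  obtain A and F :: "nat set \<Rightarrow> 'a" where A: "infinite A" and F: "loc_const A F"
    and inc: "\<And>X. X \<in> infsets A \<Longrightarrow> inc (F X) (F (shift X))"
    using not_bqo_imp_incomparable[OF neg no_descent] by blast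
  obtain T where r: "ranked T A F"
    using loc_const_imp_ranked[OF F] by blast
  obtain X G where X: "X \<in> infsets A" and G: "loc_const X G"
    and less: "\<And>Y. Y \<in> infsets X \<Longrightarrow> F (shift Y) < G Y"
    and W: "\<And>Y. Y \<in> infsets X \<Longrightarrow> \<exists>W \<in> infsets X. F W = F Y \<and> G Y = F (shift W)"
    using incomparable_dominating_map[OF no_antichain no_descent r A inc] by blast
  obtain Y where Y: "Y \<in> infsets X" and le: "le_pred (G Y) (G (shift Y))"
    using bqo_loc_const[OF bqo infsetsD(2)[OF X] G] by blast
  obtain V where V: "V \<in> infsets X" "F V = F (shift Y)" "G (shift Y) = F (shift V)"
    using W[OF shift_infsets[OF Y]] by blast
  have "F (shift Y) < G (shift Y)"
    using le less[OF Y] by (simp add: le_pred_def)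
  then show False
    using inc[OF infsets_trans[OF V(1) X]] V(2,3) by (simp add: inc_def less_imp_le)
qed

text \<open>Here \<open>F\<close> itself is bad: if \<open>le_succ (F Y) (F (shift Y))\<close>, then
  \<open>G Y\<close>, being above \<open>F (shift Y)\<close>, is above \<open>F Y\<close>. With the
  witness \<open>V\<close> for \<open>Y\<close> this reads \<open>F V < F (shift V)\<close>.\<close>

lemma bqo_le_succ_imp_bqo:
  assumes no_antichain: "\<not> (\<exists>A :: 'a::order set. infinite A \<and> antichain A)"
    and bqo: "bqo (UNIV :: 'a set) le_succ"
  shows "bqo (UNIV :: 'a set) (\<le>)"
proof (rule ccontr)
  assume neg: "\<not> ?thesis"
  have no_descent: "\<not> (\<exists>f :: nat \<Rightarrow> 'a. \<forall>i. f (Suc i) < f i)"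
    by (rule bqo_imp_no_descent[OF bqo, of id]) (auto simp: le_succ_def)
  obtain A and F :: "nat set \<Rightarrow> 'a" where A: "infinite A" and F: "loc_const A F"
    and inc: "\<And>X. X \<in> infsets A \<Longrightarrow> inc (F X) (F (shift X))"
    using not_bqo_imp_incomparable[OF neg no_descent] by blast
  obtain T where r: "ranked T A F"
    using loc_const_imp_ranked[OF F] by blast
  obtain X G where X: "X \<in> infsets A"
    and less: "\<And>Y. Y \<in> infsets X \<Longrightarrow> F (shift Y) < G Y"
    and W: "\<And>Y. Y \<in> infsets X \<Longrightarrow> \<exists>W \<in> infsets X. F W = F Y \<and> G Y = F (shift W)"
    using incomparable_dominating_map[OF no_antichain no_descent r A inc] by blast
  obtain Y where Y: "Y \<in> infsets X" and le: "le_succ (F Y) (F (shift Y))"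
    using bqo_loc_const[OF bqo infsetsD(2)[OF X] loc_const_subset[OF F infsetsD(1)[OF X]]] by blast
  obtain V where V: "V \<in> infsets X" "F V = F Y" "G Y = F (shift V)"
    using W[OF Y] by blast
  have "F Y < G Y"
    using le less[OF Y] by (simp add: le_succ_def)
  then show False
    using inc[OF infsets_trans[OF V(1) X]] V(2,3) by (simp add: inc_def less_imp_le)
qed

section \<open>Maximal antichains\<close>

lemma max_antichain_iff:
  "max_antichain A \<longleftrightarrow> antichain A \<and> (\<forall>x. \<exists>y\<in>A. x \<le> y \<or> y \<le> x)"
proof
  assume max: "max_antichain A"
  have "\<exists>y\<in>A. x \<le> y \<or> y \<le> x" for x
  proof (rule ccontr)
    assume neg: "\<not> ?thesis"
    then have "antichain (insert x A)"
      using max unfolding max_antichain_def antichain_def by blast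
    then have "x \<in> A"
      using max unfolding max_antichain_def by blast
    then show False
      using neg by blast
  qed
  then show "antichain A \<and> (\<forall>x. \<exists>y\<in>A. x \<le> y \<or> y \<le> x)"
    using max unfolding max_antichain_def by blast
next
  assume A: "antichain A \<and> (\<forall>x. \<exists>y\<in>A. x \<le> y \<or> y \<le> x)"
  have "B \<subseteq> A" if "antichain B" "A \<subseteq> B" for B
    using A that unfolding antichain_def by (metis subset_iff)
  then show "max_antichain A"
    using A unfolding max_antichain_def by blast
qed

text \<open>Zorn's lemma supplies maximal antichains before well-foundedness is known; the explicit
  ones made of minimal elements are available only afterwards.\<close>

lemma max_antichain_containing: "\<exists>M \<in> AM. (a :: 'a::order) \<in> M"
proof -
  let ?S = "{A. antichain A \<and> a \<in> A}"
  have "\<exists>M\<in>?S. \<forall>X\<in>?S. M \<subseteq> X \<longrightarrow> X = M"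
  proof (rule subset_Zorn_nonempty)
    have "{a} \<in> ?S"
      by (simp add: antichain_def)
    then show "?S \<noteq> {}"
      by blast
  next
    fix C assume C: "C \<noteq> {}" "subset.chain ?S C"
    have "antichain (\<Union>C)"
      unfolding antichain_def
    proof (intro ballI impI)
      fix x y assume "x \<in> \<Union>C" "y \<in> \<Union>C" "x \<noteq> y"
      then obtain Z where Z: "Z \<in> C" "x \<in> Z" "y \<in> Z"
        using C(2) unfolding subset_chain_def by (metis UnionE subsetD)
      then have "antichain Z"
        using C(2) unfolding subset_chain_def by blast
      then show "\<not> x \<le> y \<and> \<not> y \<le> x"
        using Z \<open>x \<noteq> y\<close> unfolding antichain_def by blast
    qed
    moreover have "a \<in> \<Union>C"
      using C unfolding subset_chain_def by blast
    ultimately show "\<Union>C \<in> ?S"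
      by simp
  qed
  then obtain M where M: "antichain M" "a \<in> M" "\<And>X. antichain X \<Longrightarrow> a \<in> X \<Longrightarrow> M \<subseteq> X \<Longrightarrow> X = M"
    by blast
  then have "max_antichain M"
    unfolding max_antichain_def by blast
  then show ?thesis
    using M(2) by (auto simp: AM_def)
qed

text \<open>The choice of a witness of non-domination is a function of \<open>F X\<close> and \<open>F (shift X)\<close>.\<close>

lemma bqo_imp_bqo_dominates:
  assumes bqo: "bqo (UNIV :: 'a::order set) (\<le>)"
  shows "bqo (Q :: 'a set set) dominates"
proof (rule bqoI_loc_const, rule ccontr)
  fix A and F :: "nat set \<Rightarrow> 'a set"
  assume A: "infinite A" and F: "loc_const A F" and neg: "\<not> (\<exists>X \<in> infsets A. dominates (F X) (F (shift X)))"
  define h where "h U V = (SOME x. x \<in> U \<and> (\<forall>y\<in>V. \<not> x \<le> y))" for U V :: "'a set"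
  define G where "G X = h (F X) (F (shift X))" for X
  have G: "G X \<in> F X \<and> (\<forall>y \<in> F (shift X). \<not> G X \<le> y)" if "X \<in> infsets A" for X
  proof -
    have "\<not> dominates (F X) (F (shift X))"
      using neg that by blast
    then have "\<exists>x. x \<in> F X \<and> (\<forall>y \<in> F (shift X). \<not> x \<le> y)"
      by (auto simp: dominates_def)
    then show ?thesis
      unfolding G_def h_def by (rule someI_ex)
  qed
  have "loc_const A G"
    unfolding G_def by (rule loc_const_map2[OF F loc_const_shift[OF F]])
  then obtain X where "X \<in> infsets A" "G X \<le> G (shift X)"
    using bqo_loc_const[OF bqo A] by blast
  then show False
    using G shift_infsets by blast
qed

text \<open>Arbitrary maximal antichains through the points yield well-foundedness first: for
  \<open>x < y\<close>, an element of \<open>m x\<close> above \<open>y\<close> would be strictly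
  above \<open>x\<close>, which also lies in \<open>m x\<close>. Then \<open>\<phi>\<close>
  transfers bad maps for \<open>le_pred\<close> to bad maps for domination.\<close>

lemma bqo_AM_imp_bqo_le_pred:
  assumes bqo: "bqo (AM :: 'a::order set set) dominates"
  shows "bqo (UNIV :: 'a set) le_pred"
proof -
  obtain m :: "'a \<Rightarrow> 'a set" where m: "\<And>a. m a \<in> AM" "\<And>a. a \<in> m a"
    using max_antichain_containing by metis
  have "\<not> dominates (m y) (m x)" if "x < y" for x y
  proof
    assume "dominates (m y) (m x)"
    then obtain z where "z \<in> m x" "y \<le> z"
      using m(2) by (auto simp: dominates_def)
    have "x \<le> z" "x \<noteq> z"
      using less_le_trans[OF that \<open>y \<le> z\<close>] by auto
    moreover have "antichain (m x)"
      using m(1)[of x] by (simp add: AM_def max_antichain_def)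
    ultimately show False
      using m(2)[of x] \<open>z \<in> m x\<close> unfolding antichain_def by blast
  qed
  then have "\<not> (\<exists>f :: nat \<Rightarrow> 'a. \<forall>i. f (Suc i) < f i)"
    by (rule bqo_imp_no_descent[OF bqo m(1)])
  then have wf: "wf {(x, y :: 'a). x < y}"
    by (simp add: wf_iff_no_infinite_down_chain)
  define \<phi> where "\<phi> a = insert a {x. inc x a \<and> (\<forall>y. inc y a \<longrightarrow> \<not> y < x)}" for a :: 'a
  \<comment> \<open>By well-foundedness, every element incomparable to \<open>a\<close> lies above a
    minimal one; this makes the antichain \<open>\<phi> a\<close> maximal.\<close>
  have minimal: "\<exists>y \<in> \<phi> a. y \<noteq> a \<and> y \<le> x" if "inc x a" for x a
    using that
  proof (induction x rule: wf_induct_rule[OF wf])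
    case (1 x)
    then show ?case
      by (cases "\<exists>y. inc y a \<and> y < x") (fastforce simp: \<phi>_def inc_def)+
  qed
  have inc: "inc x y" if "x \<in> \<phi> a" "y \<in> \<phi> a" "x \<noteq> y" for a x y
    using that unfolding \<phi>_def inc_def by (auto simp: order.order_iff_strict)
  have \<phi>_AM: "\<phi> a \<in> AM" for a
  proof -
    have "antichain (\<phi> a)"
      using inc unfolding antichain_def inc_def by blast
    moreover have "\<exists>y \<in> \<phi> a. x \<le> y \<or> y \<le> x" for x
      using minimal[of x a] by (cases "inc x a") (auto simp: \<phi>_def inc_def)
    ultimately show ?thesis
      by (simp add: AM_def max_antichain_iff)
  qed
  \<comment> \<open>Let \<open>x < a \<le> y\<close> with \<open>y\<close> in
    \<open>\<phi> b\<close>. If \<open>y\<close> is not \<open>b\<close>, it is minimal among the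
    elements incomparable to \<open>b\<close>, so \<open>x < y\<close> is comparable to
    \<open>b\<close>; and \<open>b \<le> x\<close> would put \<open>b\<close> below
    \<open>y\<close>.\<close>
  have pred: "le_pred a b" if dom: "dominates (\<phi> a) (\<phi> b)" for a b
    unfolding le_pred_def
  proof (intro allI impI)
    fix x assume "x < a"
    obtain y where y: "y \<in> \<phi> b" "a \<le> y"
      using dom by (auto simp: dominates_def \<phi>_def)
    have xy: "x < y"
      using \<open>x < a\<close> y(2) by simp
    show "x < b"
    proof (cases "y = b")
      case False
      then have yb: "inc y b"
        using inc[OF y(1), of b] by (simp add: \<phi>_def)
      then have "\<not> inc x b"
        using y(1) False xy by (auto simp: \<phi>_def)
      moreover have "\<not> b \<le> x"
        using yb xy by (meson inc_def less_imp_le order.trans)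
      ultimately show ?thesis
        by (auto simp: inc_def less_le_not_le)
    qed (use xy in simp)
  qed
  show ?thesis
  proof (rule bqoI_loc_const)
    fix A and F :: "nat set \<Rightarrow> 'a" assume A: "infinite A" and F: "loc_const A F"
    have "loc_const A (\<lambda>X. \<phi> (F X))"
      by (rule loc_const_map2[OF F F, of "\<lambda>x _. \<phi> x"])
    then show "\<exists>X \<in> infsets A. le_pred (F X) (F (shift X))"
      using bqo_loc_const[OF bqo A, of "\<lambda>X. \<phi> (F X)"] \<phi>_AM pred by blast
  qed
qed

theorem theorem1p7:
  assumes "\<not> (\<exists>A :: 'a::order set. infinite A \<and> antichain A)"
  shows "(bqo (UNIV :: 'a set) (\<le>) \<longleftrightarrow> bqo (UNIV :: 'a set) le_succ)
       \<and> (bqo (UNIV :: 'a set) (\<le>) \<longleftrightarrow> bqo (UNIV :: 'a set) le_pred)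
       \<and> (bqo (UNIV :: 'a set) (\<le>) \<longleftrightarrow> bqo (UNIV :: 'a set) le_crit)
       \<and> (bqo (UNIV :: 'a set) (\<le>) \<longleftrightarrow> bqo (AM :: 'a set set) dominates)"
proof -
  have le_crit: "bqo (UNIV :: 'a set) (\<le>) \<Longrightarrow> bqo (UNIV :: 'a set) le_crit"
    by (erule bqo_mono) (auto simp: le_crit_def le_pred_def le_succ_def)
  have crit_succ: "bqo (UNIV :: 'a set) le_crit \<Longrightarrow> bqo (UNIV :: 'a set) le_succ"
    and crit_pred: "bqo (UNIV :: 'a set) le_crit \<Longrightarrow> bqo (UNIV :: 'a set) le_pred"
    by (erule bqo_mono, simp add: le_crit_def)+
  \<comment> \<open>The implications used are (i) to (iv), (iv) to (ii) and (iii), each of these to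
    (i), then (i) to (v) and (v) to (iii).\<close>
  show ?thesis
    using le_crit crit_succ crit_pred bqo_le_pred_imp_bqo[OF assms] bqo_le_succ_imp_bqo[OF assms]
      bqo_imp_bqo_dominates bqo_AM_imp_bqo_le_pred
    by (metis (no_types))
qed

end
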